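(* For every weight vector $\mathbf{w}=(w_1,w_2,\dots)$ of non-negative reals with $w_1=1$ and $\mathbf{w}\neq(1,\frac12,\frac13,\dots)$, the rule $\mathbf{w}$-$\mathit{PAV}$ does not satisfy EJR; that is, there exist a candidate set $C$, a ballot profile $\vec{A}$ over $C$ and a target committee size $k$ such that the committee output by $\mathbf{w}$-$\mathit{PAV}$ on $(\vec{A},k)$ (whatever the tie-breaking rule) does not provide extended justified representation for $(\vec{A},k)$.
   Context: Setting. $N=\{1,\dots,n\}$ ($n\ge 1$) is a set of voters, $C$ is a finite set of candidates. Each voter $i\in N$ submits an approval ballot $A_i\subseteq C$; the list $\vec{A}=(A_1,\dots,A_n)$ is the ballot profile. An approval-based multi-winner rule takes $(N,C,\vec{A},k)$ with $1\le k\le|C|$ and returns a committee $W\subseteq C$ with $|W|=k$. Extended justified representation (EJR). For a positive integer $\ell\le k$, a set $W\subseteq C$ with $|W|=k$ provides $\ell$-justified representation ($\ell$-JR) for $(\vec{A},k)$ if there is no set of voters $N^*\subseteq N$ with $|N^*|\ge\ell\cdot\frac nk$ such that $|\bigcap_{i\in N^*}A_i|\ge\ell$ but $|A_i\cap W|<\ell$ for each $i\in N^*$. $W$ provides EJR for $(\vec{A},k)$ if it provides $\ell$-JR for all $\ell$ with $1\le\ell\le k$. $\mathbf{w}$-$\mathit{PAV}$: the $\mathbf{w}$-$\mathit{PAV}$ score of $W\subseteq C$ is $\sum_{i\in N}r_{\mathbf{w}}(|W\cap A_i|)$, where $r_{\mathbf{w}}(p)=\sum_{j=1}^p w_j$;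 $\mathbf{w}$-$\mathit{PAV}$ outputs a set $W\subseteq C$ of size $k$ with the highest $\mathbf{w}$-$\mathit{PAV}$ score. The weight vector is not required to be non-increasing and does not depend on the profile. *)

theory Defs
  imports Complex_Main
begin

text \<open>
  Voters are \<open>{1..n}\<close>. A profile is a function \<open>A :: nat \<Rightarrow> 'c set\<close>, of which only
  the values at \<open>1, \<dots>, n\<close> are used. A weight vector is a function \<open>w :: nat \<Rightarrow> real\<close> whose
  entries are \<open>w 1, w 2, \<dots>\<close>; the value \<open>w 0\<close> is never used.
\<close>

definition election :: "nat \<Rightarrow> 'c set \<Rightarrow> (nat \<Rightarrow> 'c set) \<Rightarrow> nat \<Rightarrow> bool" where
  "election n C A k \<longleftrightarrow>
     1 \<le> n \<and> finite C \<and> (\<forall>i\<in>{1..n}. A i \<subseteq> C) \<and> 1 \<le> k \<and> k \<le> card C"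

definition committees :: "'c set \<Rightarrow> nat \<Rightarrow> 'c set set" where
  "committees C k = {W. W \<subseteq> C \<and> card W = k}"

definition provides_JR :: "nat \<Rightarrow> nat \<Rightarrow> (nat \<Rightarrow> 'c set) \<Rightarrow> nat \<Rightarrow> 'c set \<Rightarrow> bool" where
  "provides_JR l n A k W \<longleftrightarrow>
     \<not> (\<exists>V \<subseteq> {1..n}. real (card V) \<ge> real l * (real n / real k) \<and>
          card (\<Inter>i\<in>V. A i) \<ge> l \<and> (\<forall>i\<in>V. card (A i \<inter> W) < l))"

definition provides_EJR :: "nat \<Rightarrow> (nat \<Rightarrow> 'c set) \<Rightarrow> nat \<Rightarrow> 'c set \<Rightarrow> bool" where
  "provides_EJR n A k W \<longleftrightarrow> (\<forall>l\<in>{1..k}. provides_JR l n A k W)"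

definition r_w :: "(nat \<Rightarrow> real) \<Rightarrow> nat \<Rightarrow> real" where
  "r_w w p = (\<Sum>j=1..p. w j)"

definition PAV_score :: "(nat \<Rightarrow> real) \<Rightarrow> nat \<Rightarrow> (nat \<Rightarrow> 'c set) \<Rightarrow> 'c set \<Rightarrow> real" where
  "PAV_score w n A W = (\<Sum>i\<in>{1..n}. r_w w (card (W \<inter> A i)))"

text \<open>
  The set of all committees with the highest score; a tie-breaking rule selects one of its elements.
\<close>

definition PAV_winners ::
  "(nat \<Rightarrow> real) \<Rightarrow> nat \<Rightarrow> 'c set \<Rightarrow> (nat \<Rightarrow> 'c set) \<Rightarrow> nat \<Rightarrow> 'c set set" where
  "PAV_winners w n C A k =
     {W \<in> committees C k. \<forall>W'\<in>committees C k. PAV_score w n A W' \<le> PAV_score w n A W}"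

lemma PAV_winners_nonempty:
  assumes "election n C A k"
  shows "PAV_winners w n C A k \<noteq> {}"
proof -
  have fin: "finite (committees C k)"
    using assms by (auto simp: election_def committees_def)
  have "committees C k \<noteq> {}"
    using assms obtain_subset_with_card_n[of k C]
    by (auto simp: election_def committees_def)
  then have "Max (PAV_score w n A ` committees C k) \<in> PAV_score w n A ` committees C k"
    using fin by simp
  then obtain W where W: "W \<in> committees C k"
    "PAV_score w n A W = Max (PAV_score w n A ` committees C k)"
    by auto
  then have "W \<in> PAV_winners w n C A k"
    using fin by (auto simp: PAV_winners_def)
  then show ?thesis by blast
qed

end

theory Submission
  imports Defs
begin

text \<open>
  Take pairwise disjoint groups of voters, each approving its own block of candidates, and let the
  committee size \<open>k\<close> be one less than the number of candidates. Omitting a candidate of a block of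
  size \<open>p\<close> with \<open>x\<close> supporters costs \<open>x * w p\<close>, so \<open>w\<close>-PAV omits a candidate from a block where
  this is least. If \<open>s * w s < t * w t\<close>, use one block of size \<open>s\<close> with \<open>s * m\<close> supporters and \<open>m\<close>
  blocks of size \<open>t\<close> with \<open>m * t - 1\<close> supporters each. Then \<open>n = m * k\<close>, so the first group is just
  large enough to deserve all its \<open>s\<close> candidates, but for large \<open>m\<close> it is the one that loses a
  candidate. Comparing \<open>j * w j\<close> with \<open>1 * w 1 = 1\<close> gives such a pair \<open>s, t\<close>.
\<close>

text \<open>Starting from all of \<open>C\<close>, voter \<open>i\<close> has all
  \<open>card (A i)\<close> approved candidates elected. Dropping \<open>a\<close> costs a supporter
  of \<open>a\<close> exactly the last summand \<open>w (card (A i))\<close> and leaves everyone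
  else's satisfaction unchanged.\<close>

lemma PAV_score_remove:
  assumes "finite C" "\<And>i. i \<in> {1..n} \<Longrightarrow> A i \<subseteq> C"
  shows "PAV_score w n A (C - {a}) =
           PAV_score w n A C - (\<Sum>i | i \<in> {1..n} \<and> a \<in> A i. w (card (A i)))"
proof -
  have "r_w w (card ((C - {a}) \<inter> A i)) =
          r_w w (card (C \<inter> A i)) - (if a \<in> A i then w (card (A i)) else 0)" if "i \<in> {1..n}" for i
  proof -
    have sub: "A i \<subseteq> C" and fin: "finite (A i)"
      using assms that finite_subset by blast+
    have eq: "(C - {a}) \<inter> A i = A i - {a}" "C \<inter> A i = A i"
      using sub by auto
    show ?thesis
    proof (cases "a \<in> A i")
      case True
      have "card (A i) = Suc (card (A i - {a}))"
        using fin True by (rule card.remove)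
      then have "r_w w (card (A i)) = r_w w (card (A i - {a})) + w (card (A i))"
        by (simp only: r_w_def) simp
      then show ?thesis
        using True by (simp add: eq)
    next
      case False
      then show ?thesis
        by (simp add: eq)
    qed
  qed
  then have "PAV_score w n A (C - {a}) =
      (\<Sum>i\<in>{1..n}. r_w w (card (C \<inter> A i)) - (if a \<in> A i then w (card (A i)) else 0))"
    unfolding PAV_score_def by (rule sum.cong[OF refl])
  also have "\<dots> = PAV_score w n A C - (\<Sum>i\<in>{1..n}. if a \<in> A i then w (card (A i)) else 0)"
    by (simp add: sum_subtractf PAV_score_def)
  also have "(\<Sum>i\<in>{1..n}. if a \<in> A i then w (card (A i)) else 0) =
               (\<Sum>i | i \<in> {1..n} \<and> a \<in> A i. w (card (A i)))"
    by (rule sum.inter_filter[symmetric]) simp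
  finally show ?thesis .
qed

text \<open>A committee of size \<open>k\<close> leaves out a single candidate, so maximising the
  score amounts to minimising the loss given by \<open>PAV_score_remove\<close>.\<close>

lemma PAV_winner_omits_cheapest:
  assumes C: "finite C" "card C = Suc k" and A: "\<And>i. i \<in> {1..n} \<Longrightarrow> A i \<subseteq> C"
    and W: "W \<in> PAV_winners w n C A k"
  obtains b where "b \<in> C" "W = C - {b}"
    "\<And>a. a \<in> C \<Longrightarrow> (\<Sum>i | i \<in> {1..n} \<and> b \<in> A i. w (card (A i)))
                   \<le> (\<Sum>i | i \<in> {1..n} \<and> a \<in> A i. w (card (A i)))"
proof -
  have WC: "W \<subseteq> C" "card W = k"
    using W by (auto simp: PAV_winners_def committees_def)
  then have "card (C - W) = 1"
    using C by (simp add: card_Diff_subset finite_subset)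
  then obtain b where b: "C - W = {b}"
    by (auto simp: card_1_singleton_iff)
  then have "b \<in> C" and Wb: "W = C - {b}"
    using WC by auto
  moreover have "(\<Sum>i | i \<in> {1..n} \<and> b \<in> A i. w (card (A i)))
                   \<le> (\<Sum>i | i \<in> {1..n} \<and> a \<in> A i. w (card (A i)))" if "a \<in> C" for a
  proof -
    have "C - {a} \<in> committees C k"
      using C that by (auto simp: committees_def)
    then have "PAV_score w n A (C - {a}) \<le> PAV_score w n A (C - {b})"
      using W unfolding PAV_winners_def Wb by auto
    then show ?thesis
      using PAV_score_remove[where w = w, OF C(1) A] by simp
  qed
  ultimately show thesis
    using that by blast
qed

text \<open>Turns a block index computed by \<open>div\<close> into interval bounds; used with
  \<open>d = t\<close> for blocks of candidates and \<open>d = y\<close> for groups of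
  voters.\<close>

lemma nat_div_eq_iff:
  fixes d p q :: nat
  assumes "d \<ge> 1"
  shows "p div d = q \<longleftrightarrow> q * d \<le> p \<and> p < Suc q * d"
proof
  assume "p div d = q"
  then show "q * d \<le> p \<and> p < Suc q * d"
    using assms dividend_less_div_times[of d p] div_times_less_eq_dividend[of p d] by auto
next
  assume "q * d \<le> p \<and> p < Suc q * d"
  then show "p div d = q"
    by (intro div_nat_eqI) (auto simp: mult.commute)
qed

lemma PAV_fails_EJR:
  fixes w :: "nat \<Rightarrow> real" and s t :: nat
  assumes nonneg: "\<And>j. j \<ge> 1 \<Longrightarrow> w j \<ge> 0"
    and st: "s \<ge> 1" "t \<ge> 1" and less: "real s * w s < real t * w t"
  shows "\<exists>(n::nat) (C::nat set) (A::nat \<Rightarrow> nat set) (k::nat).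
           election n C A k \<and> (\<forall>W\<in>PAV_winners w n C A k. \<not> provides_EJR n A k W)"
proof -
  \<comment> \<open>\<open>m\<close> is chosen so large that the gap
    \<open>m * (t * w t - s * w s)\<close> outweighs the \<open>w t\<close> lost by giving each
    large block \<open>m * t - 1\<close> rather than \<open>m * t\<close> supporters.\<close>
  obtain m :: nat where m: "w t < real m * (real t * w t - real s * w s)"
    using less reals_Archimedean3[of "real t * w t - real s * w s"] by auto
  have m1: "m \<ge> 1"
    using m nonneg[OF st(2)] by (cases m) auto
  define y where "y = m * t - 1"
  have mt: "m * t = Suc y"
    using m1 st by (simp add: y_def)
  have mt_real: "real m * real t = real y + 1"
    using arg_cong[OF mt, of real] by simp
  have cost: "real (s * m) * w s < real y * w t"
  proof -
    have "w t + real (s * m) * w s < (real m * real t) * w t"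
      using m by (simp add: algebra_simps)
    then show ?thesis
      by (simp add: mt_real algebra_simps)
  qed
  have y1: "y \<ge> 1"
    using cost nonneg[OF st(1)] by (cases y) (auto simp: mult_less_0_iff)
  define n where "n = s * m + m * y"
  define k where "k = s + m * t - 1"
  define C where "C = {..<s + m * t}"
  define B where "B = (\<lambda>q. {s + q * t ..< s + Suc q * t})"
  \<comment> \<open>Voters are numbered from 1, so the offset \<open>s * m + 1\<close> makes the
    quotient by \<open>y\<close> start at 0 with the first voter after the initial group.\<close>
  define A where "A = (\<lambda>i. if i \<le> s * m then {..<s} else B ((i - s * m - 1) div y))"
  \<comment> \<open>The missing supporter in \<open>y = m * t - 1\<close> makes this exact:
    \<open>s * m + m * (m * t - 1) = m * (s + m * t - 1)\<close>.\<close>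
  have nk: "n = m * k"
    using mt by (simp add: n_def k_def algebra_simps)
  have C: "finite C" "card C = Suc k"
    using st by (auto simp: C_def k_def)
  have sk: "s \<le> k"
    using mt y1 by (simp add: k_def)
  have A_sub: "A i \<subseteq> C" if "i \<in> {1..n}" for i
  proof (cases "i \<le> s * m")
    case False
    then have "(i - s * m - 1) div y < m"
      using that y1 by (auto simp: n_def less_mult_imp_div_less)
    then have "Suc ((i - s * m - 1) div y) * t \<le> m * t"
      by (intro mult_le_mono1) simp
    then show ?thesis
      using False by (auto simp: A_def B_def C_def)
  qed (auto simp: A_def C_def)
  have "election n C A k"
    using C A_sub sk st m1 unfolding election_def nk by auto
  moreover have "\<not> provides_EJR n A k W" if W: "W \<in> PAV_winners w n C A k" for W
  proof -
    obtain b where b: "b \<in> C" "W = C - {b}"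
      and cheap: "\<And>a. a \<in> C \<Longrightarrow> (\<Sum>i | i \<in> {1..n} \<and> b \<in> A i. w (card (A i)))
                   \<le> (\<Sum>i | i \<in> {1..n} \<and> a \<in> A i. w (card (A i)))"
      using PAV_winner_omits_cheapest[OF C A_sub W] by blast
    \<comment> \<open>Otherwise \<open>b\<close> lies in a block of size \<open>t\<close>, and by
      \<open>cost\<close> omitting candidate 0 of the first block would be strictly cheaper.\<close>
    have "b < s"
    proof (rule ccontr)
      assume "\<not> b < s"
      then have bs: "s \<le> b" by simp
      define q where "q = (b - s) div t"
      have qm: "q < m"
        using b(1) bs unfolding q_def C_def by (intro less_mult_imp_div_less) auto
      have block: "c \<in> B p \<longleftrightarrow> s \<le> c \<and> (c - s) div t = p" for c p
        using st(2) by (auto simp: B_def nat_div_eq_iff)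
      have first: "{i. i \<in> {1..n} \<and> 0 \<in> A i} = {1..s * m}"
        using st by (auto simp: A_def B_def n_def)
      have sup: "{i. i \<in> {1..n} \<and> b \<in> A i} = {s * m + 1 + q * y ..< s * m + 1 + Suc q * y}"
      proof -
        \<comment> \<open>The \<open>q\<close>-th run of \<open>y\<close> voters ends no later than
          \<open>n = s * m + m * y\<close>, so all of it lies in the electorate.\<close>
        have le: "Suc q * y \<le> m * y"
          using qm by (intro mult_le_mono1) simp
        have "i \<in> {1..n} \<and> b \<in> A i \<longleftrightarrow>
                s * m < i \<and> i \<le> n \<and> (i - s * m - 1) div y = q" for i
          using bs by (auto simp: A_def block simp flip: q_def)
        also have "\<dots> i \<longleftrightarrow> i \<in> {s * m + 1 + q * y ..< s * m + 1 + Suc q * y}" for i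
          using le unfolding nat_div_eq_iff[OF y1] n_def atLeastLessThan_iff by arith
        finally show ?thesis
          by blast
      qed
      have "(\<Sum>i | i \<in> {1..n} \<and> b \<in> A i. w (card (A i))) = real y * w t"
        unfolding sup by (simp add: A_def B_def)
      moreover have "(\<Sum>i | i \<in> {1..n} \<and> 0 \<in> A i. w (card (A i))) = real (s * m) * w s"
        unfolding first by (simp add: A_def)
      moreover have "0 \<in> C"
        using st by (simp add: C_def)
      ultimately show False
        using cheap[of 0] cost by simp
    qed
    have "\<not> provides_JR s n A k W"
      unfolding provides_JR_def not_not
    proof (intro exI conjI)
      show "{1..s * m} \<subseteq> {1..n}"
        by (auto simp: n_def)
      \<comment> \<open>Since \<open>n / k = m\<close>, the first group meets the quota with
        equality.\<close>
      show "real s * (real n / real k) \<le> real (card {1..s * m})"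
        using sk st by (simp add: nk)
      have "(\<Inter>i\<in>{1..s * m}. A i) = {..<s}"
        using st m1 by (auto simp: A_def)
      then show "s \<le> card (\<Inter>i\<in>{1..s * m}. A i)"
        by simp
      have "card ({..<s} \<inter> W) < s"
        using \<open>b < s\<close> b(2) psubset_card_mono[of "{..<s}" "{..<s} \<inter> W"] by auto
      then show "\<forall>i\<in>{1..s * m}. card (A i \<inter> W) < s"
        by (simp add: A_def)
    qed
    then show ?thesis
      using sk st by (auto simp: provides_EJR_def)
  qed
  ultimately show ?thesis
    by blast
qed

theorem theorem11:
  fixes w :: "nat \<Rightarrow> real"
  assumes "\<And>j. j \<ge> 1 \<Longrightarrow> w j \<ge> 0"
    and "w 1 = 1"
    and "\<exists>j\<ge>1. w j \<noteq> 1 / real j"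
  shows "\<exists>(n::nat) (C::nat set) (A::nat \<Rightarrow> nat set) (k::nat).
           election n C A k \<and> (\<forall>W\<in>PAV_winners w n C A k. \<not> provides_EJR n A k W)"
proof -
  obtain j where j: "j \<ge> 1" "w j \<noteq> 1 / real j"
    using assms(3) by blast
  then have "real j * w j \<noteq> real 1 * w 1"
    using assms(2) by (auto simp: field_simps)
  \<comment> \<open>The index with the smaller product plays the role of \<open>s\<close>: the
    deserving group approves \<open>j\<close> candidates in the first case and a single one in the
    second.\<close>
  then consider "real j * w j < real 1 * w 1" | "real 1 * w 1 < real j * w j"
    by linarith
  then show ?thesis
  proof cases
    case 1
    show ?thesis
      by (rule PAV_fails_EJR[OF assms(1) j(1) order_refl 1])
  next
    case 2
    show ?thesis
      by (rule PAV_fails_EJR[OF assms(1) order_refl j(1) 2])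
  qed
qed

end
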